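(* Let $k\geq 2$ and let $H$ be a connected $k$-graph of order $h$ with maximum degree $\Delta=\Delta(H)$ and maximum disjoint degree $\Delta_0=\Delta_{0}(H)$. Then there exists a constant $\alpha=\alpha(k,\Delta_0)$ (depending only on $k$ and $\Delta_0$) such that \[ \mathrm{d}_{\mathrm{crit}}(H)\leq 1-\frac{1}{\alpha\Delta}. \] Moreover, unless $H$ is $\Delta$-regular, there also exists a constant $\beta=\beta(k,h)$ (depending only on $k$ and $h$) such that \[ \mathrm{d}_{\mathrm{crit}}(H)\leq 1-\frac{1}{\beta(\Delta-1)}. \] Both constants satisfy $\alpha,\beta\leq k\left(\frac{k}{k-1}\right)^{k-1}<ke$.
   Context: A $k$-graph $H$ has a vertex set $V(H)$ and edge set $E(H)\subseteq\binom{V(H)}{k}$. The neighbourhood of $v\in V(H)$ is $\Gamma_H(v)=\{B\in\binom{V(H)}{k-1}: \{v\}\cup B\in E(H)\}$; the degree of $v$ is $|\Gamma_H(v)|$ and $\Delta(H)=\max_v|\Gamma_H(v)|$. The maximum disjoint degree is $\Delta_0(H)=\max_{v\in V(H)}\max\{j: \text{there exist pairwise disjoint } B_1,\dots,B_j\in\Gamma_H(v)\}$. $H$ is $\Delta$-regular if every vertex has degree $\Delta$. Given $H$ with $V(H)=\{v_1,\dots,v_h\}$, a complete blow-up $\hat H$ is obtained by replacing each $v_i$ by a non-empty class $A_i$ of $a_i$ vertices (classes disjoint) and taking as edges all $k$-sets containing exactly one vertex from each of $A_{b_1},\dots,A_{b_k}$ for every edge $v_{b_1}\cdots v_{b_k}\in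 E(H)$. A blow-up of $H$ is any subgraph $G\subseteq\hat H$. For $e\in E(H)$, $G[e]$ is the $k$-partite subgraph of $G$ induced by $\bigcup_{v_i\in e}A_i$, and $d_e(G)=|E(G[e])|/\prod_{v_i\in e}a_i$; set $d(G)=\min_{e\in E(H)}d_e(G)$. An $H$-transversal in $G$ is a subgraph of $G$ isomorphic to $H$ with exactly one vertex in each class $A_i$ (and, correspondingly, containing the edge of $G$ on the representatives of each edge of $H$); $G$ is $H$-free if it contains no $H$-transversal. The critical edge density is $\mathrm{d}_{\mathrm{crit}}(H)=\sup\{d(G): G \text{ is an } H\text{-free blow-up of } H\}$. *)

theory Defs
  imports Complex_Main "HOL-Library.Disjoint_Sets"
begin

record 'a hypergraph =
  verts :: "'a set"
  edges :: "'a set set"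

definition k_graph :: "nat \<Rightarrow> 'a hypergraph \<Rightarrow> bool" where
  "k_graph k H \<longleftrightarrow> finite (verts H) \<and> edges H \<subseteq> {e. e \<subseteq> verts H \<and> card e = k}"

definition connected_hypergraph :: "'a hypergraph \<Rightarrow> bool" where
  "connected_hypergraph H \<longleftrightarrow> verts H \<noteq> {} \<and>
     (\<forall>u\<in>verts H. \<forall>v\<in>verts H. (u, v) \<in> {(x, y). \<exists>e\<in>edges H. x \<in> e \<and> y \<in> e}\<^sup>*)"

definition neighbourhood :: "nat \<Rightarrow> 'a hypergraph \<Rightarrow> 'a \<Rightarrow> 'a set set" where
  "neighbourhood k H v = {B. B \<subseteq> verts H \<and> card B = k - 1 \<and> {v} \<union> B \<in> edges H}"

definition vertex_degree :: "nat \<Rightarrow> 'a hypergraph \<Rightarrow> 'a \<Rightarrow> nat" where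
  "vertex_degree k H v = card (neighbourhood k H v)"

definition max_degree :: "nat \<Rightarrow> 'a hypergraph \<Rightarrow> nat" where
  "max_degree k H = Max (vertex_degree k H ` verts H)"

definition max_disjoint_degree :: "nat \<Rightarrow> 'a hypergraph \<Rightarrow> nat" where
  "max_disjoint_degree k H =
     Max ((\<lambda>v. Max {card \<B> | \<B>. \<B> \<subseteq> neighbourhood k H v \<and> disjoint \<B>}) ` verts H)"

definition regular_hypergraph :: "nat \<Rightarrow> nat \<Rightarrow> 'a hypergraph \<Rightarrow> bool" where
  "regular_hypergraph k d H \<longleftrightarrow> (\<forall>v\<in>verts H. vertex_degree k H v = d)"

definition subhypergraph :: "'a hypergraph \<Rightarrow> 'a hypergraph \<Rightarrow> bool" where
  "subhypergraph G K \<longleftrightarrow>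
     verts G \<subseteq> verts K \<and> edges G \<subseteq> edges K \<and> (\<forall>f\<in>edges G. f \<subseteq> verts G)"

definition hypergraph_iso :: "('a \<Rightarrow> 'b) \<Rightarrow> 'a hypergraph \<Rightarrow> 'b hypergraph \<Rightarrow> bool" where
  "hypergraph_iso \<phi> H K \<longleftrightarrow>
     bij_betw \<phi> (verts H) (verts K) \<and> edges K = (\<lambda>e. \<phi> ` e) ` edges H"

definition blow_up_classes :: "'a hypergraph \<Rightarrow> ('a \<Rightarrow> 'b set) \<Rightarrow> bool" where
  "blow_up_classes H A \<longleftrightarrow>
     (\<forall>v\<in>verts H. finite (A v) \<and> A v \<noteq> {}) \<and> disjoint_family_on A (verts H)"

definition complete_blow_up :: "'a hypergraph \<Rightarrow> ('a \<Rightarrow> 'b set) \<Rightarrow> 'b hypergraph" where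
  "complete_blow_up H A =
     \<lparr>verts = (\<Union>v\<in>verts H. A v),
      edges = {f. \<exists>e\<in>edges H. f \<subseteq> (\<Union>v\<in>e. A v) \<and> (\<forall>v\<in>e. card (f \<inter> A v) = 1)}\<rparr>"

definition blow_up :: "'a hypergraph \<Rightarrow> ('a \<Rightarrow> 'b set) \<Rightarrow> 'b hypergraph \<Rightarrow> bool" where
  "blow_up H A G \<longleftrightarrow> blow_up_classes H A \<and> subhypergraph G (complete_blow_up H A)"

definition edge_density :: "('a \<Rightarrow> 'b set) \<Rightarrow> 'b hypergraph \<Rightarrow> 'a set \<Rightarrow> real" where
  "edge_density A G e =
     real (card {f \<in> edges G. f \<subseteq> (\<Union>v\<in>e. A v)}) / (\<Prod>v\<in>e. real (card (A v)))"

definition min_density :: "'a hypergraph \<Rightarrow> ('a \<Rightarrow> 'b set) \<Rightarrow> 'b hypergraph \<Rightarrow> real" where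
  "min_density H A G = Min (edge_density A G ` edges H)"

text \<open>The isomorphism sends each vertex of \<open>H\<close> to the representative of its own class.\<close>

definition transversal ::
  "'a hypergraph \<Rightarrow> ('a \<Rightarrow> 'b set) \<Rightarrow> 'b hypergraph \<Rightarrow> 'b hypergraph \<Rightarrow> bool" where
  "transversal H A G T \<longleftrightarrow> subhypergraph T G \<and>
     (\<exists>\<phi>. hypergraph_iso \<phi> H T \<and> (\<forall>v\<in>verts H. verts T \<inter> A v = {\<phi> v}))"

definition transversal_free :: "'a hypergraph \<Rightarrow> ('a \<Rightarrow> 'b set) \<Rightarrow> 'b hypergraph \<Rightarrow> bool" where
  "transversal_free H A G \<longleftrightarrow> \<not> (\<exists>T. transversal H A G T)"

text \<open>Blow-ups of finite hypergraphs are finite, so each is isomorphic to one whose vertices are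
  natural numbers.  The supremum is meaningful when \<open>H\<close> has at least one edge.\<close>

definition d_crit :: "'a hypergraph \<Rightarrow> real" where
  "d_crit H = Sup {min_density H A G | (A :: 'a \<Rightarrow> nat set) G.
                     blow_up H A G \<and> transversal_free H A G}"

end

theory Submission
  imports Defs "HOL-Library.FuncSet"
begin

text \<open>
  Choose one vertex from every class independently and uniformly at random, and let \<open>f S\<close> be the
  probability that all edges of \<open>H\<close> inside \<open>S\<close> are realised in \<open>G\<close>.  If every edge density is at
  least \<open>1 - p\<close>, then independence and the union bound give
  \<open>f (S \<union> {v}) \<ge> f S - p * (\<Sum>e. f (S - e))\<close>, the sum being over the edges \<open>e \<ni> v\<close> inside \<open>S \<union> {v}\<close>.
  With \<open>x = (k - 1) / k\<close>, which maximises \<open>x ^ (k - 1) * (1 - x)\<close>, induction yields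
  \<open>f (S \<union> {v}) \<ge> x * f S\<close> whenever at most \<open>D\<close> such edges exist and \<open>D * p \<le> x ^ (k - 1) * (1 - x)\<close>:
  restoring the vertices of \<open>e - {v}\<close> to \<open>S - e\<close> one at a time costs a factor \<open>1 / x\<close> each, because
  each of them has lost the edge \<open>e\<close> and so has at most \<open>D\<close> edges left if \<open>\<Delta> \<le> D + 1\<close>.
  One may take \<open>D = \<Delta>\<close> always.  If \<open>H\<close> is connected and not regular, one may take \<open>D = \<Delta> - 1\<close>: every
  nonempty proper \<open>S\<close> contains a vertex with an edge leaving \<open>S\<close>, and \<open>V(H)\<close> contains a vertex of
  degree less than \<open>\<Delta>\<close>.  Hence \<open>f (V(H)) > 0\<close>.
\<close>

section \<open>Independence over disjoint sets of classes, in counting form\<close>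

text \<open>A choice function on a disjoint union corresponds to the pair of its restrictions, and
  any two such restrictions glue back together.\<close>

lemma card_PiE_filter_Un:
  assumes "I \<inter> J = {}"
  shows "card {\<phi> \<in> PiE (I \<union> J) A. P (restrict \<phi> I) \<and> Q (restrict \<phi> J)} =
         card {\<phi> \<in> PiE I A. P \<phi>} * card {\<phi> \<in> PiE J A. Q \<phi>}"
proof -
  let ?g = "\<lambda>(\<phi>, \<psi>). \<lambda>i. if i \<in> I then \<phi> i else \<psi> i"
  have "bij_betw (\<lambda>\<phi>. (restrict \<phi> I, restrict \<phi> J))
          {\<phi> \<in> PiE (I \<union> J) A. P (restrict \<phi> I) \<and> Q (restrict \<phi> J)}
          ({\<phi> \<in> PiE I A. P \<phi>} \<times> {\<phi> \<in> PiE J A. Q \<phi>})"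
  proof (rule bij_betw_byWitness[where f' = ?g])
    show "\<forall>\<phi>\<in>{\<phi> \<in> PiE (I \<union> J) A. P (restrict \<phi> I) \<and> Q (restrict \<phi> J)}.
            ?g (restrict \<phi> I, restrict \<phi> J) = \<phi>"
      by (auto simp: fun_eq_iff PiE_def extensional_def)
    have restr: "restrict (\<lambda>i. if i \<in> I then \<phi> i else \<psi> i) I = \<phi>"
      "restrict (\<lambda>i. if i \<in> I then \<phi> i else \<psi> i) J = \<psi>"
      if "\<phi> \<in> PiE I A" "\<psi> \<in> PiE J A" for \<phi> \<psi>
      using that assms by (auto simp: fun_eq_iff PiE_def extensional_def)
    then show "\<forall>q\<in>{\<phi> \<in> PiE I A. P \<phi>} \<times> {\<phi> \<in> PiE J A. Q \<phi>}.
            (restrict (?g q) I, restrict (?g q) J) = q"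
      by auto
    show "(\<lambda>\<phi>. (restrict \<phi> I, restrict \<phi> J)) `
            {\<phi> \<in> PiE (I \<union> J) A. P (restrict \<phi> I) \<and> Q (restrict \<phi> J)}
          \<subseteq> {\<phi> \<in> PiE I A. P \<phi>} \<times> {\<phi> \<in> PiE J A. Q \<phi>}"
      by (auto simp: PiE_def)
    show "?g ` ({\<phi> \<in> PiE I A. P \<phi>} \<times> {\<phi> \<in> PiE J A. Q \<phi>})
          \<subseteq> {\<phi> \<in> PiE (I \<union> J) A. P (restrict \<phi> I) \<and> Q (restrict \<phi> J)}"
      using restr by (auto simp: PiE_def extensional_def)
  qed
  then show ?thesis
    by (simp add: bij_betw_same_card card_cartesian_product)
qed

section \<open>The random choice and its growth estimate\<close>

text \<open>\<open>F\<close> stands for the edge set of the blow-up. Degrees may reach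
  \<open>Suc D\<close>, one more than \<open>p_small\<close> accounts for; the missing unit is
  gained whenever an edge at the vertex sticks out of the current set.\<close>

locale random_choice =
  fixes V :: "'a set" and E :: "'a set set" and A :: "'a \<Rightarrow> 'b set" and F :: "'b set set"
    and k D :: nat and p x :: real
  assumes finite_V: "finite V"
    and edge_subset: "e \<in> E \<Longrightarrow> e \<subseteq> V"
    and edge_card: "e \<in> E \<Longrightarrow> card e = k"
    and k_pos: "0 < k"
    and finite_class: "v \<in> V \<Longrightarrow> finite (A v)"
    and class_nonempty: "v \<in> V \<Longrightarrow> A v \<noteq> {}"
    and few_bad: "e \<in> E \<Longrightarrow>
      real (card {\<phi> \<in> PiE e A. \<phi> ` e \<notin> F}) \<le> p * (\<Prod>v\<in>e. real (card (A v)))"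
    and degree_le: "v \<in> V \<Longrightarrow> card {e \<in> E. v \<in> e} \<le> Suc D"
    and p_nonneg: "0 \<le> p"
    and x_pos: "0 < x"
    and p_small: "real D * p \<le> x ^ (k - 1) * (1 - x)"
begin

text \<open>Choices range over all of \<open>V\<close> for every \<open>S\<close>, so the sets for
  different \<open>S\<close> live in one space and their cardinalities are proportional to the
  probabilities \<open>f S\<close>.\<close>

definition good :: "'a set \<Rightarrow> ('a \<Rightarrow> 'b) set" where
  "good S = {\<phi> \<in> PiE V A. \<forall>e\<in>E. e \<subseteq> S \<longrightarrow> \<phi> ` e \<in> F}"

lemma finite_E: "finite E"
  using finite_V edge_subset by (meson Pow_iff finite_Pow_iff finite_subset subsetI)

lemma finite_good: "finite (good S)"
  unfolding good_def using finite_V finite_class by (simp add: finite_PiE)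

text \<open>Failure of \<open>e\<close> is decided by the choices on \<open>e\<close>, membership in
  \<open>good (S - e)\<close> by those on \<open>V - e\<close>; the two events are
  independent.\<close>

lemma card_bad_good_le:
  assumes e: "e \<in> E" and "S \<subseteq> V"
  shows "real (card {\<phi> \<in> good (S - e). \<phi> ` e \<notin> F}) \<le> p * real (card (good (S - e)))"
proof -
  let ?Q = "\<lambda>\<psi>. \<forall>e'\<in>E. e' \<subseteq> S - e \<longrightarrow> \<psi> ` e' \<in> F"
  have V: "V = e \<union> (V - e)" and disj: "e \<inter> (V - e) = {}"
    using edge_subset[OF e] by auto
  have Q: "?Q \<phi> \<longleftrightarrow> ?Q (restrict \<phi> (V - e))" for \<phi>
  proof -
    have "restrict \<phi> (V - e) ` e' = \<phi> ` e'" if "e' \<subseteq> S - e" for e'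
      using that \<open>S \<subseteq> V\<close> by (intro image_cong) auto
    then show ?thesis by auto
  qed
  have "{\<phi> \<in> good (S - e). \<phi> ` e \<notin> F} =
     {\<phi> \<in> PiE (e \<union> (V - e)) A. restrict \<phi> e ` e \<notin> F \<and> ?Q (restrict \<phi> (V - e))}"
    unfolding good_def V[symmetric] using Q by auto
  then have bad: "card {\<phi> \<in> good (S - e). \<phi> ` e \<notin> F} =
     card {\<phi> \<in> PiE e A. \<phi> ` e \<notin> F} * card {\<psi> \<in> PiE (V - e) A. ?Q \<psi>}"
    by (simp only: card_PiE_filter_Un[OF disj, where P = "\<lambda>\<phi>. \<phi> ` e \<notin> F" and Q = ?Q])
  have "good (S - e) = {\<phi> \<in> PiE (e \<union> (V - e)) A. True \<and> ?Q (restrict \<phi> (V - e))}"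
    unfolding good_def V[symmetric] using Q by auto
  then have good: "card (good (S - e)) = card (PiE e A) * card {\<psi> \<in> PiE (V - e) A. ?Q \<psi>}"
    using card_PiE_filter_Un[OF disj, where P = "\<lambda>\<phi>. True" and Q = ?Q and A = A] by simp
  have "finite e"
    using edge_subset[OF e] finite_V finite_subset by blast
  then have "real (card (PiE e A)) = (\<Prod>v\<in>e. real (card (A v)))"
    by (simp add: card_PiE)
  then have "real (card {\<phi> \<in> PiE e A. \<phi> ` e \<notin> F}) \<le> p * real (card (PiE e A))"
    using few_bad[OF e] by simp
  from mult_right_mono[OF this, of "real (card {\<psi> \<in> PiE (V - e) A. ?Q \<psi>})"] show ?thesis
    unfolding bad good of_nat_mult by (simp add: mult.assoc)
qed

text \<open>The induction treats all \<open>v\<close> at once, because its hypothesis is applied to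
  smaller sets with other vertices of the edges through \<open>v\<close> in the role of
  \<open>v\<close>.\<close>

lemma card_good_insert_ge:
  assumes "S \<subseteq> V" "v \<in> V" "v \<notin> S" "card {e \<in> E. v \<in> e \<and> e \<subseteq> insert v S} \<le> D"
  shows "x * real (card (good S)) \<le> real (card (good (insert v S)))"
  using finite_subset[OF assms(1) finite_V] assms
proof (induction S arbitrary: v rule: finite_psubset_induct)
  case (psubset S)
  define Ev where "Ev = {e \<in> E. v \<in> e \<and> e \<subseteq> insert v S}"
  let ?B = "\<lambda>e. {\<phi> \<in> good (S - e). \<phi> ` e \<notin> F}"
  have finEv: "finite Ev"
    using finite_E by (simp add: Ev_def)
  \<comment> \<open>Union bound: a choice lost in passing from \<open>S\<close> to
    \<open>insert v S\<close> fails on an edge \<open>e\<close> through \<open>v\<close>. Weakening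
    \<open>good S\<close> to \<open>good (S - e)\<close> makes this failure independent of the
    rest.\<close>
  have cover: "good S \<subseteq> good (insert v S) \<union> (\<Union>e\<in>Ev. ?B e)"
  proof
    fix \<phi> assume \<phi>: "\<phi> \<in> good S"
    show "\<phi> \<in> good (insert v S) \<union> (\<Union>e\<in>Ev. ?B e)"
    proof (cases "\<phi> \<in> good (insert v S)")
      case False
      then obtain e where e: "e \<in> E" "e \<subseteq> insert v S" "\<phi> ` e \<notin> F"
        using \<phi> by (auto simp: good_def)
      then have "v \<in> e"
        using \<phi> by (auto simp: good_def subset_insert)
      moreover have "\<phi> \<in> good (S - e)"
        using \<phi> by (auto simp: good_def)
      ultimately show ?thesis
        using e by (auto simp: Ev_def)
    qed simp
  qed
  have "finite (?B e)" for e
    using finite_good by simp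
  then have "finite (good (insert v S) \<union> (\<Union>e\<in>Ev. ?B e))"
    using finite_good finEv by blast
  then have "card (good S) \<le> card (good (insert v S) \<union> (\<Union>e\<in>Ev. ?B e))"
    using cover by (rule card_mono)
  also have "\<dots> \<le> card (good (insert v S)) + card (\<Union>e\<in>Ev. ?B e)"
    by (rule card_Un_le)
  also have "\<dots> \<le> card (good (insert v S)) + (\<Sum>e\<in>Ev. card (?B e))"
    using card_UN_le[OF finEv] by simp
  finally have union: "real (card (good S)) \<le>
      real (card (good (insert v S))) + (\<Sum>e\<in>Ev. real (card (?B e)))"
    unfolding of_nat_sum[symmetric] of_nat_add[symmetric] of_nat_le_iff .
  have restore: "x ^ (k - 1) * real (card (good (S - e))) \<le> real (card (good S))"
    if "e \<in> Ev" for e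
  proof -
    have e: "e \<in> E" "v \<in> e" "e \<subseteq> insert v S"
      using that by (auto simp: Ev_def)
    have "finite e"
      using edge_card[OF e(1)] k_pos by (intro card_ge_0_finite) simp
    then have "finite (e - {v})" by simp
    moreover have "U \<subseteq> e - {v} \<Longrightarrow>
        x ^ card U * real (card (good (S - e))) \<le> real (card (good ((S - e) \<union> U)))"
      if "finite U" for U
      using that
    proof (induction U rule: finite_induct)
      case empty
      then show ?case by simp
    next
      case (insert u U)
      have u: "u \<in> e" "u \<noteq> v" "u \<in> S" "u \<in> V" and U: "U \<subseteq> S"
        using insert.prems e(3) psubset.prems(1) by auto
      \<comment> \<open>The edge \<open>e\<close> contains \<open>v\<close>, which lies outside the
        current set, so \<open>e\<close> drops out of the count at \<open>u\<close>.\<close>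
      have "{e' \<in> E. u \<in> e' \<and> e' \<subseteq> insert u ((S - e) \<union> U)} \<subseteq> {e' \<in> E. u \<in> e'} - {e}"
        using e(2) u(2) U psubset.prems(3) by auto
      then have "card {e' \<in> E. u \<in> e' \<and> e' \<subseteq> insert u ((S - e) \<union> U)}
          \<le> card ({e' \<in> E. u \<in> e'} - {e})"
        by (intro card_mono) (auto simp: finite_E)
      also have "\<dots> \<le> D"
        using degree_le[OF u(4)] e(1) u(1) finite_E by (simp add: card_Diff_singleton)
      finally have deg: "card {e' \<in> E. u \<in> e' \<and> e' \<subseteq> insert u ((S - e) \<union> U)} \<le> D" .
      have "(S - e) \<union> U \<subset> S"
        using u insert.hyps U by blast
      from psubset.IH[OF this _ u(4) _ deg]
      have step: "x * real (card (good ((S - e) \<union> U))) \<le> real (card (good (insert u ((S - e) \<union> U))))"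
        using U u(1) insert.hyps psubset.prems(1) by blast
      have "x ^ card (insert u U) * real (card (good (S - e))) =
          x * (x ^ card U * real (card (good (S - e))))"
        using insert.hyps by simp
      also have "\<dots> \<le> x * real (card (good ((S - e) \<union> U)))"
        using insert.IH insert.prems x_pos by (intro mult_left_mono) auto
      also note step
      finally show ?case by simp
    qed
    ultimately have "x ^ card (e - {v}) * real (card (good (S - e)))
        \<le> real (card (good ((S - e) \<union> (e - {v}))))"
      by blast
    moreover have "(S - e) \<union> (e - {v}) = S"
      using e psubset.prems(3) by auto
    ultimately show ?thesis
      using e(2) edge_card[OF e(1)] \<open>finite e\<close> by simp
  qed
  \<comment> \<open>The factor \<open>x ^ (k - 1)\<close> lets \<open>restore\<close> replace each
    \<open>good (S - e)\<close> by \<open>good S\<close>; it cancels at the end against the one in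
    \<open>p_small\<close>.\<close>
  have "x ^ (k - 1) * (\<Sum>e\<in>Ev. real (card (?B e))) = (\<Sum>e\<in>Ev. x ^ (k - 1) * real (card (?B e)))"
    by (simp add: sum_distrib_left)
  also have "\<dots> \<le> (\<Sum>e\<in>Ev. p * real (card (good S)))"
  proof (rule sum_mono)
    fix e assume e: "e \<in> Ev"
    then have "real (card (?B e)) \<le> p * real (card (good (S - e)))"
      using card_bad_good_le psubset.prems(1) by (auto simp: Ev_def)
    then have "x ^ (k - 1) * real (card (?B e)) \<le> x ^ (k - 1) * (p * real (card (good (S - e))))"
      using x_pos by (intro mult_left_mono) auto
    also have "\<dots> = p * (x ^ (k - 1) * real (card (good (S - e))))"
      by simp
    also have "\<dots> \<le> p * real (card (good S))"
      using restore[OF e] p_nonneg by (intro mult_left_mono) auto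
    finally show "x ^ (k - 1) * real (card (?B e)) \<le> p * real (card (good S))" .
  qed
  also have "\<dots> = real (card Ev) * p * real (card (good S))"
    by simp
  also have "\<dots> \<le> real D * p * real (card (good S))"
    using psubset.prems(4) p_nonneg by (intro mult_right_mono) (auto simp: Ev_def)
  also have "\<dots> \<le> x ^ (k - 1) * (1 - x) * real (card (good S))"
    using p_small by (intro mult_right_mono) auto
  finally have "(\<Sum>e\<in>Ev. real (card (?B e))) \<le> (1 - x) * real (card (good S))"
    using x_pos by (simp add: mult.assoc)
  with union show ?case
    by (simp add: algebra_simps)
qed

text \<open>Low-degree vertices are removed one at a time. Putting one back costs at most the
  positive factor \<open>x\<close>, so nonemptiness climbs up from the empty set.\<close>

lemma good_nonempty:
  assumes low: "\<And>S. S \<subseteq> V \<Longrightarrow> S \<noteq> {} \<Longrightarrow> \<exists>v\<in>S. card {e \<in> E. v \<in> e \<and> e \<subseteq> S} \<le> D"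
    and "S \<subseteq> V"
  shows "good S \<noteq> {}"
  using finite_subset[OF assms(2) finite_V] assms(2)
proof (induction S rule: finite_psubset_induct)
  case (psubset S)
  show ?case
  proof (cases "S = {}")
    case True
    have "PiE V A \<noteq> {}"
      using class_nonempty by (auto simp: PiE_eq_empty_iff)
    moreover have "{} \<notin> E"
      using edge_card k_pos by fastforce
    ultimately show ?thesis
      using True by (auto simp: good_def)
  next
    case False
    then obtain v where v: "v \<in> S" "card {e \<in> E. v \<in> e \<and> e \<subseteq> S} \<le> D"
      using low psubset.prems by blast
    then have ins: "insert v (S - {v}) = S" by auto
    have "good (S - {v}) \<noteq> {}"
      using psubset v by blast
    then have "0 < x * real (card (good (S - {v})))"
      using x_pos finite_good by (simp add: card_gt_0_iff)
    also have "\<dots> \<le> real (card (good S))"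
      using card_good_insert_ge[of "S - {v}" v, unfolded ins] v psubset.prems by auto
    finally show ?thesis by auto
  qed
qed

end

section \<open>Degrees and connectivity\<close>

lemma card_incident_edges_le:
  assumes "k_graph k H"
  shows "card {e \<in> edges H. v \<in> e} \<le> vertex_degree k H v"
  unfolding vertex_degree_def
proof (rule card_inj_on_le[where f = "\<lambda>e. e - {v}"])
  show "inj_on (\<lambda>e. e - {v}) {e \<in> edges H. v \<in> e}"
    by (auto simp: inj_on_def)
  show "(\<lambda>e. e - {v}) ` {e \<in> edges H. v \<in> e} \<subseteq> neighbourhood k H v"
    using assms finite_subset
    by (fastforce simp: k_graph_def neighbourhood_def insert_absorb)
  have "neighbourhood k H v \<subseteq> Pow (verts H)"
    by (auto simp: neighbourhood_def)
  then show "finite (neighbourhood k H v)"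
    using assms finite_subset by (auto simp: k_graph_def)
qed

lemma vertex_degree_le_max_degree:
  assumes "k_graph k H" "v \<in> verts H"
  shows "vertex_degree k H v \<le> max_degree k H"
  using assms by (simp add: k_graph_def max_degree_def)

text \<open>A path from a vertex of \<open>S\<close> to one outside must cross the boundary of
  \<open>S\<close> along some edge.\<close>

lemma connected_edge_leaving:
  assumes "connected_hypergraph H" "S \<subset> verts H" "S \<noteq> {}"
  obtains e v where "e \<in> edges H" "v \<in> e" "v \<in> S" "\<not> e \<subseteq> S"
proof -
  obtain u w where "u \<in> S" "w \<in> verts H" "w \<notin> S"
    using assms by blast
  then have "(u, w) \<in> {(x, y). \<exists>e\<in>edges H. x \<in> e \<and> y \<in> e}\<^sup>*"
    using assms by (auto simp: connected_hypergraph_def)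
  then have "\<exists>e\<in>edges H. \<exists>v\<in>e. v \<in> S \<and> \<not> e \<subseteq> S"
    using \<open>u \<in> S\<close> \<open>w \<notin> S\<close> by (induction rule: converse_rtrancl_induct) blast+
  then show thesis
    using that by blast
qed

text \<open>Edges have at least two vertices, so \<open>{v}\<close> is a proper subset and some edge
  leaves it.\<close>

lemma connected_vertex_in_edge:
  assumes "connected_hypergraph H" "k_graph k H" "2 \<le> k" "edges H \<noteq> {}" "v \<in> verts H"
  obtains e where "e \<in> edges H" "v \<in> e"
proof -
  obtain e where e: "e \<in> edges H" "e \<subseteq> verts H" "card e = k"
    using assms by (auto simp: k_graph_def)
  then have "\<not> e \<subseteq> {v}"
    using assms(3) card_mono[of "{v}" e] by auto
  then have "{v} \<subset> verts H"
    using e assms(5) by blast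
  then show thesis
    using connected_edge_leaving[OF assms(1), of "{v}"] that by blast
qed

section \<open>From blow-ups to choice functions\<close>

text \<open>Each edge of \<open>G\<close> within the classes of \<open>e\<close> is the image of the
  choice that picks its vertex in every class.\<close>

lemma card_good_edge_choices_ge:
  assumes H: "k_graph k H" and G: "blow_up H A G" and e: "e \<in> edges H"
  shows "card {f \<in> edges G. f \<subseteq> (\<Union>v\<in>e. A v)} \<le> card {\<phi> \<in> PiE e A. \<phi> ` e \<in> edges G}"
proof (rule surj_card_le)
  have sub: "e' \<subseteq> verts H" "card e' = k" "finite e'" if "e' \<in> edges H" for e'
    using H that finite_subset by (auto simp: k_graph_def)
  have disj: "disjoint_family_on A (verts H)" and fin: "\<And>v. v \<in> verts H \<Longrightarrow> finite (A v)"
    using G by (auto simp: blow_up_def blow_up_classes_def)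
  show "finite {\<phi> \<in> PiE e A. \<phi> ` e \<in> edges G}"
    using sub[OF e] fin by (intro finite_Collect_conjI disjI1) (auto intro!: finite_PiE)
  show "{f \<in> edges G. f \<subseteq> (\<Union>v\<in>e. A v)} \<subseteq> (\<lambda>\<phi>. \<phi> ` e) ` {\<phi> \<in> PiE e A. \<phi> ` e \<in> edges G}"
  proof
    fix f assume "f \<in> {f \<in> edges G. f \<subseteq> (\<Union>v\<in>e. A v)}"
    then have f: "f \<in> edges G" "f \<subseteq> (\<Union>v\<in>e. A v)" by auto
    then obtain e' where e': "e' \<in> edges H" "f \<subseteq> (\<Union>v\<in>e'. A v)" "\<forall>v\<in>e'. card (f \<inter> A v) = 1"
      using G by (auto simp: blow_up_def subhypergraph_def complete_blow_up_def)
    \<comment> \<open>The edge \<open>f\<close> could a priori arise from another edge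
      \<open>e'\<close> of \<open>H\<close>. Disjoint classes force this inclusion, and equal
      cardinality then gives \<open>e' = e\<close>.\<close>
    have "e' \<subseteq> e"
    proof
      fix v assume v: "v \<in> e'"
      then have "card (f \<inter> A v) = 1"
        using e' by blast
      then obtain y where y: "y \<in> f" "y \<in> A v"
        by (metis Int_iff card_1_singletonE insertI1)
      with f obtain u where "u \<in> e" "y \<in> A u" by auto
      moreover have "u \<in> verts H" "v \<in> verts H"
        using sub(1)[OF e] sub(1)[OF e'(1)] v \<open>u \<in> e\<close> by auto
      ultimately show "v \<in> e"
        using disj y(2) by (metis disjoint_family_on_def disjoint_iff)
    qed
    then have "e' = e"
      using sub[OF e] sub[OF e'(1)] by (simp add: card_subset_eq)
    then have "\<forall>v\<in>e. \<exists>y. f \<inter> A v = {y}"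
      using e'(3) card_1_singletonE by metis
    then obtain \<phi> where \<phi>: "\<And>v. v \<in> e \<Longrightarrow> f \<inter> A v = {\<phi> v}"
      by metis
    have "f = (\<Union>v\<in>e. f \<inter> A v)"
      using f(2) by auto
    also have "\<dots> = restrict \<phi> e ` e"
      using \<phi> by auto
    finally have "f = restrict \<phi> e ` e" .
    moreover have "restrict \<phi> e \<in> PiE e A"
      using \<phi> by auto
    ultimately show "f \<in> (\<lambda>\<phi>. \<phi> ` e) ` {\<phi> \<in> PiE e A. \<phi> ` e \<in> edges G}"
      using f(1) by blast
  qed
qed

text \<open>Passing to the complement turns the density bound into the hypothesis
  \<open>few_bad\<close> of the locale.\<close>

lemma card_bad_edge_choices_le:
  assumes H: "k_graph k H" and G: "blow_up H A G" and e: "e \<in> edges H"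
    and dens: "1 - p \<le> min_density H A G"
  shows "real (card {\<phi> \<in> PiE e A. \<phi> ` e \<notin> edges G}) \<le> p * (\<Prod>v\<in>e. real (card (A v)))"
proof -
  let ?N = "\<Prod>v\<in>e. real (card (A v))"
  have sub: "e \<subseteq> verts H" "finite e"
    using H e finite_subset by (auto simp: k_graph_def)
  have cls: "finite (A v)" "A v \<noteq> {}" if "v \<in> e" for v
    using G sub that by (auto simp: blow_up_def blow_up_classes_def)
  have N: "0 < ?N"
    using cls by (intro prod_pos) (simp add: card_gt_0_iff)
  have "edges H \<subseteq> Pow (verts H)"
    using H by (auto simp: k_graph_def)
  then have "finite (edges H)"
    using H finite_subset by (auto simp: k_graph_def)
  then have "min_density H A G \<le> edge_density A G e"
    using e by (simp add: min_density_def)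
  then have "(1 - p) * ?N \<le> edge_density A G e * ?N"
    using dens N by (intro mult_right_mono) auto
  also have "\<dots> = real (card {f \<in> edges G. f \<subseteq> (\<Union>v\<in>e. A v)})"
    using N by (simp add: edge_density_def)
  also have "\<dots> \<le> real (card {\<phi> \<in> PiE e A. \<phi> ` e \<in> edges G})"
    using card_good_edge_choices_ge[OF H G e] by simp
  finally have good: "(1 - p) * ?N \<le> real (card {\<phi> \<in> PiE e A. \<phi> ` e \<in> edges G})" .
  have fin: "finite (PiE e A)"
    using sub cls by (simp add: finite_PiE)
  have "PiE e A = {\<phi> \<in> PiE e A. \<phi> ` e \<in> edges G} \<union> {\<phi> \<in> PiE e A. \<phi> ` e \<notin> edges G}"
    by auto
  then have "card (PiE e A) =
      card {\<phi> \<in> PiE e A. \<phi> ` e \<in> edges G} + card {\<phi> \<in> PiE e A. \<phi> ` e \<notin> edges G}"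
    using fin by (subst card_Un_disjoint[symmetric]) auto
  moreover have "real (card (PiE e A)) = ?N"
    using sub by (simp add: card_PiE)
  ultimately show ?thesis
    using good by (simp add: algebra_simps)
qed

lemma transversal_of_choice:
  assumes H: "k_graph k H" "connected_hypergraph H" "edges H \<noteq> {}" "2 \<le> k"
    and G: "blow_up H A G"
    and \<phi>: "\<phi> \<in> PiE (verts H) A" "\<And>e. e \<in> edges H \<Longrightarrow> \<phi> ` e \<in> edges G"
  shows "transversal H A G \<lparr>verts = \<phi> ` verts H, edges = (\<lambda>e. \<phi> ` e) ` edges H\<rparr>"
proof -
  have disj: "disjoint_family_on A (verts H)"
    using G by (auto simp: blow_up_def blow_up_classes_def)
  have unique: "u = v" if "u \<in> verts H" "v \<in> verts H" "\<phi> u \<in> A v" for u v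
    using disj that \<phi>(1) unfolding disjoint_family_on_def by (fastforce simp: PiE_iff)
  \<comment> \<open>A blow-up may omit vertices of its classes; the representative is present
    because some edge of \<open>H\<close> through \<open>v\<close> has its image in
    \<open>G\<close>.\<close>
  have "\<phi> v \<in> verts G" if v: "v \<in> verts H" for v
  proof -
    obtain e where "e \<in> edges H" "v \<in> e"
      using connected_vertex_in_edge[OF H(2,1,4,3) v] .
    then show ?thesis
      using \<phi>(2) G by (fastforce simp: blow_up_def subhypergraph_def)
  qed
  moreover have "\<phi> ` e \<subseteq> \<phi> ` verts H" if "e \<in> edges H" for e
    using that H(1) by (auto simp: k_graph_def)
  moreover have "inj_on \<phi> (verts H)"
    using unique \<phi>(1) by (metis PiE_mem inj_onI)
  moreover have "\<phi> ` verts H \<inter> A v = {\<phi> v}" if "v \<in> verts H" for v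
    using unique that \<phi>(1) by (auto simp: PiE_iff)
  ultimately show ?thesis
    using \<phi>(2) unfolding transversal_def subhypergraph_def hypergraph_iso_def
    by (auto intro!: exI[of _ \<phi>] simp: bij_betw_def)
qed

text \<open>The low-degree vertices demanded by \<open>good_nonempty\<close> are \<open>w\<close>
  for the whole vertex set and a boundary vertex for any proper subset.\<close>

lemma dense_blow_up_has_transversal:
  assumes H: "k_graph k H" "connected_hypergraph H" "edges H \<noteq> {}" "2 \<le> k"
    and deg: "\<And>v. v \<in> verts H \<Longrightarrow> vertex_degree k H v \<le> Suc D"
    and w: "w \<in> verts H" "vertex_degree k H w \<le> D"
    and x: "0 < x" and p: "0 \<le> p" "real D * p \<le> x ^ (k - 1) * (1 - x)"
    and G: "blow_up H A G" and dens: "1 - p \<le> min_density H A G"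
  shows "\<not> transversal_free H A G"
proof -
  interpret random_choice "verts H" "edges H" A "edges G" k D p x
  proof
    show "card {e \<in> edges H. v \<in> e} \<le> Suc D" if "v \<in> verts H" for v
      using card_incident_edges_le[OF H(1)] deg[OF that] le_trans by blast
    show "real (card {\<phi> \<in> PiE e A. \<phi> ` e \<notin> edges G}) \<le> p * (\<Prod>v\<in>e. real (card (A v)))"
      if "e \<in> edges H" for e
      using card_bad_edge_choices_le[OF H(1) G that dens] .
  qed (use H G x p in \<open>auto simp: k_graph_def blow_up_def blow_up_classes_def\<close>)
  have "\<exists>v\<in>S. card {e \<in> edges H. v \<in> e \<and> e \<subseteq> S} \<le> D"
    if S: "S \<subseteq> verts H" "S \<noteq> {}" for S
  proof (cases "S = verts H")
    case True
    have "card {e \<in> edges H. w \<in> e \<and> e \<subseteq> S} \<le> card {e \<in> edges H. w \<in> e}"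
      by (intro card_mono) (auto simp: finite_E)
    then show ?thesis
      using True w card_incident_edges_le[OF H(1), of w] le_trans by blast
  next
    case False
    then obtain e v where e: "e \<in> edges H" "v \<in> e" "v \<in> S" "\<not> e \<subseteq> S"
      using connected_edge_leaving[OF H(2), of S] S by blast
    have "card {e \<in> edges H. v \<in> e \<and> e \<subseteq> S} \<le> card ({e \<in> edges H. v \<in> e} - {e})"
      using e by (intro card_mono) (auto simp: finite_E)
    also have "\<dots> \<le> D"
      using degree_le[of v] e S finite_E by (auto simp: card_Diff_singleton)
    finally show ?thesis
      using e by blast
  qed
  then have "good (verts H) \<noteq> {}"
    by (intro good_nonempty) auto
  then obtain \<phi> where "\<phi> \<in> PiE (verts H) A" "\<And>e. e \<in> edges H \<Longrightarrow> \<phi> ` e \<in> edges G"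
    using edge_subset by (auto simp: good_def)
  then show ?thesis
    using transversal_of_choice[OF H G] unfolding transversal_free_def by blast
qed

section \<open>The critical density and the constant\<close>

text \<open>A supremum of reals is bounded via its upper bounds only if the set is nonempty.
  Singleton classes with the empty graph provide a member.\<close>

lemma transversal_free_blow_up_exists:
  assumes "k_graph k H" "edges H \<noteq> {}"
  obtains A :: "'a \<Rightarrow> nat set" and G where "blow_up H A G" "transversal_free H A G"
proof -
  obtain i :: "'a \<Rightarrow> nat" where i: "inj_on i (verts H)"
    using assms finite_imp_inj_to_nat_seg[of "verts H"] by (auto simp: k_graph_def)
  let ?G = "\<lparr>verts = {}, edges = {}\<rparr> :: nat hypergraph"
  have "blow_up H (\<lambda>v. {i v}) ?G"
    using i by (auto simp: blow_up_def blow_up_classes_def subhypergraph_def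
        disjoint_family_on_def inj_on_def)
  moreover have "transversal_free H (\<lambda>v. {i v}) ?G"
    using assms by (auto simp: transversal_free_def transversal_def subhypergraph_def
        hypergraph_iso_def)
  ultimately show thesis
    using that by blast
qed

lemma d_crit_le:
  assumes H: "k_graph k H" "connected_hypergraph H" "edges H \<noteq> {}" "2 \<le> k"
    and deg: "\<And>v. v \<in> verts H \<Longrightarrow> vertex_degree k H v \<le> Suc D"
    and w: "w \<in> verts H" "vertex_degree k H w \<le> D"
  shows "d_crit H \<le> 1 - 1 / (real k * (real k / (real k - 1)) ^ (k - 1) * real D)"
proof -
  define x where "x = (real k - 1) / real k"
  define c where "c = real k * (real k / (real k - 1)) ^ (k - 1)"
  \<comment> \<open>Here \<open>1 / c\<close> is the maximum of
    \<open>x ^ (k - 1) * (1 - x)\<close>, so for \<open>D > 0\<close> this \<open>p\<close> makes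
    \<open>p_small\<close> an equality; for \<open>D = 0\<close> the convention
    \<open>1 / 0 = 0\<close> gives \<open>p = 0\<close>.\<close>
  define p where "p = 1 / (c * real D)"
  have x: "0 < x"
    using H(4) by (simp add: x_def)
  have c: "0 < c"
    using H(4) by (simp add: c_def)
  have "x ^ (k - 1) * (1 - x) = 1 / c"
    using H(4) by (simp add: x_def c_def field_simps power_divide)
  then have p: "0 \<le> p" "real D * p \<le> x ^ (k - 1) * (1 - x)"
    using c by (auto simp: p_def)
  have "min_density H A G \<le> 1 - p" if "blow_up H A G" "transversal_free H A G"
    for A :: "'a \<Rightarrow> nat set" and G
    using dense_blow_up_has_transversal[OF H deg w x p that(1)] that(2) by fastforce
  moreover obtain A :: "'a \<Rightarrow> nat set" and G where "blow_up H A G" "transversal_free H A G"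
    using transversal_free_blow_up_exists[OF H(1,3)] .
  ultimately have "d_crit H \<le> 1 - p"
    unfolding d_crit_def by (intro cSup_least) auto
  then show ?thesis
    by (simp add: p_def c_def)
qed

text \<open>With \<open>n = k - 1\<close> this is \<open>(1 + 1 / n) ^ n < exp 1\<close>, the
  \<open>n\<close>-th power of \<open>1 + t < exp t\<close> at \<open>t = 1 / n\<close>.\<close>

lemma power_one_plus_inverse_less_exp:
  assumes "2 \<le> k"
  shows "(real k / (real k - 1)) ^ (k - 1) < exp 1"
proof -
  have eq: "real k / (real k - 1) = 1 + 1 / real (k - 1)"
    using assms by (simp add: field_simps of_nat_diff)
  have "1 + 1 / real (k - 1) < exp (1 / real (k - 1))"
    using ln_add_one_self_less_self[of "1 / real (k - 1)"] assms
    by (smt (verit, best) exp_less_mono exp_ln divide_pos_pos of_nat_0_less_iff zero_less_diff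
        Suc_1 Suc_le_lessD)
  then have "(1 + 1 / real (k - 1)) ^ (k - 1) < exp (1 / real (k - 1)) ^ (k - 1)"
    using assms by (intro power_strict_mono) auto
  also have "\<dots> = exp 1"
    using assms by (simp flip: exp_of_nat_mult)
  finally show ?thesis
    by (simp only: eq)
qed

theorem theorem4:
  "\<exists>\<alpha> \<beta> :: nat \<Rightarrow> nat \<Rightarrow> real.
     (\<forall>k\<ge>2. \<forall>H :: 'a hypergraph.
        k_graph k H \<and> connected_hypergraph H \<and> edges H \<noteq> {} \<longrightarrow>
          d_crit H \<le> 1 - 1 / (\<alpha> k (max_disjoint_degree k H) * real (max_degree k H)) \<and>
          (\<not> regular_hypergraph k (max_degree k H) H \<longrightarrow>
             d_crit H \<le> 1 - 1 / (\<beta> k (card (verts H)) * (real (max_degree k H) - 1)))) \<and>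
     (\<forall>k\<ge>2. \<forall>m.
        0 < \<alpha> k m \<and> \<alpha> k m \<le> real k * (real k / (real k - 1)) ^ (k - 1) \<and>
        0 < \<beta> k m \<and> \<beta> k m \<le> real k * (real k / (real k - 1)) ^ (k - 1) \<and>
        real k * (real k / (real k - 1)) ^ (k - 1) < real k * exp 1)"
proof -
  \<comment> \<open>One function serves as both \<alpha> and \<beta>; its value depends on
    \<open>k\<close> alone.\<close>
  define c where "c = (\<lambda>k (m :: nat). real k * (real k / (real k - 1)) ^ (k - 1))"
  have bound: "d_crit H \<le> 1 - 1 / (c k m * real (max_degree k H))"
    "\<not> regular_hypergraph k (max_degree k H) H \<Longrightarrow>
       d_crit H \<le> 1 - 1 / (c k m * (real (max_degree k H) - 1))"
    if k: "2 \<le> k" and H: "k_graph k H" "connected_hypergraph H" "edges H \<noteq> {}"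
    for k m and H :: "'a hypergraph"
  proof -
    note le = vertex_degree_le_max_degree[OF H(1)]
    obtain v where "v \<in> verts H"
      using H(2) by (auto simp: connected_hypergraph_def)
    \<comment> \<open>With \<open>D\<close> the maximum degree, any vertex can act as
      \<open>w\<close>.\<close>
    then show "d_crit H \<le> 1 - 1 / (c k m * real (max_degree k H))"
      using d_crit_le[OF H k, of "max_degree k H" v] le by (simp add: c_def le_SucI)
    assume "\<not> regular_hypergraph k (max_degree k H) H"
    then obtain w where w: "w \<in> verts H" "vertex_degree k H w < max_degree k H"
      using le by (force simp: regular_hypergraph_def)
    \<comment> \<open>Now \<open>D\<close> is the maximum degree minus one. The existence of
      \<open>w\<close> makes the maximum degree positive, so natural and real subtraction
      agree.\<close>
    then have "d_crit H \<le> 1 - 1 / (c k m * real (max_degree k H - 1))"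
      using d_crit_le[OF H k, of "max_degree k H - 1" w] le by (simp add: c_def)
    then show "d_crit H \<le> 1 - 1 / (c k m * (real (max_degree k H) - 1))"
      using w by (simp add: of_nat_diff)
  qed
  have pos: "0 < c k m" if "2 \<le> k" for k m
    using that by (simp add: c_def)
  have less: "real k * (real k / (real k - 1)) ^ (k - 1) < real k * exp 1" if "2 \<le> k" for k
    using power_one_plus_inverse_less_exp[OF that] that by simp
  show ?thesis
    using bound pos less by (intro exI[of _ c]) (auto simp: c_def)
qed

end
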